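(* Let $\pi\in\Pi$ and $\lambda\ge0$. Let $\mathcal{B}^\lambda(\pi)=\mathbb{E}[\hat{R}^\lambda_n(\pi)]-R(\pi)$ and $\mathcal{V}^\lambda(\pi)=\mathbb{E}\big[(\hat{R}^\lambda_n(\pi)-\mathbb{E}[\hat{R}^\lambda_n(\pi)])^2\big]$ be respectively the bias and the variance of the Logarithmic Smoothing estimator $\hat{R}^\lambda_n(\pi)$. Then $$0\le\mathcal{B}^\lambda(\pi)\le\lambda\,\mathcal{S}_\lambda(\pi)\qquad\text{and}\qquad \mathcal{V}^\lambda(\pi)\le\frac{\mathcal{S}_\lambda(\pi)}{n}.$$ Moreover, for any $\lambda>0$ the variance is finite, as $$\mathcal{V}^\lambda(\pi)\le\frac{|R(\pi)|}{\lambda n}\le\frac{1}{\lambda n}.$$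
   Context: Setting (offline contextual bandit). $\mathcal{X}\subset\mathbb{R}^d$ is a compact context space, $\mathcal{A}=\{1,\dots,K\}$ a finite action set, $\nu$ a probability distribution on $\mathcal{X}$. A policy $\pi$ assigns to each $x\in\mathcal{X}$ a probability distribution $\pi(\cdot|x)$ on $\mathcal{A}$; $\Pi$ is the set of policies and $\pi_0$ is a fixed behavior policy. Given $(x,a)$, a cost $c\in[-1,0]$ is drawn from a distribution $p(\cdot|x,a)$, with mean $c(x,a)$. The logged data $\mathcal{D}_n=(x_i,a_i,c_i)_{i\in[n]}$ consists of $n$ i.i.d. tuples with $x_i\sim\nu$, $a_i\sim\pi_0(\cdot|x_i)$, $c_i\sim p(\cdot|x_i,a_i)$. The risk of a policy is $R(\pi)=\mathbb{E}_{x\sim\nu,\,a\sim\pi(\cdot|x)}[c(x,a)]$. Expectations $\mathbb{E}$ without subscript are with respect to the logging distribution ($x\sim\nu$, $a\sim\pi_0(\cdot|x)$, $c\sim p(\cdot|x,a)$, and i.i.d. copies for $\mathcal{D}_n$). Coverage assumption: for $\nu$-almost every $x$ and every $a$, $\pi(a|x)>0$ implies $\pi_0(a|x)>0$. Notation. $w_\pi(x,a)=\pi(a|x)/\pi_0(a|x)$. For $\lambda>0$ the Logarithmic Smoothing estimator is $$\hat{R}^\lambda_n(\pi)=-\frac1n\sum_{i=1}^n\frac1\lambda\log\big(1-\lambda w_\pi(x_i,a_i)c_i\big),$$ and for $\lambda=0$ it is $\hat{R}^0_n(\pi)=\frac1n\sum_{i=1}^n w_\pi(x_i,a_i)c_i$.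 Also $$\mathcal{S}_\lambda(\pi)=\mathbb{E}\left[\frac{(w_\pi(x,a)c)^2}{1-\lambda w_\pi(x,a)c}\right]$$ (possibly $+\infty$ when $\lambda=0$; for $\lambda=0$ the product $\lambda\,\mathcal{S}_\lambda(\pi)$ is read as $0$). *)

theory Defs
  imports "HOL-Probability.Probability"
begin

abbreviation context_space :: "'x::topological_space set \<Rightarrow> 'x measure" where
  "context_space X \<equiv> restrict_space borel X"

abbreviation action_space :: "nat \<Rightarrow> nat measure" where
  "action_space K \<equiv> count_space {1..K}"

abbreviation cost_space :: "real measure" where
  "cost_space \<equiv> restrict_space borel {-1..0}"

abbreviation sample_space :: "'x::topological_space set \<Rightarrow> nat \<Rightarrow> ('x \<times> nat \<times> real) measure" where
  "sample_space X K \<equiv> context_space X \<Otimes>\<^sub>M (action_space K \<Otimes>\<^sub>M cost_space)"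

text \<open>The probability of action \<open>a\<close> in context \<open>x\<close> under a policy \<open>\<pi>\<close> is \<open>measure (\<pi> x) {a}\<close>.\<close>

definition policies :: "'x::topological_space set \<Rightarrow> nat \<Rightarrow> ('x \<Rightarrow> nat measure) set" where
  "policies X K = context_space X \<rightarrow>\<^sub>M prob_algebra (action_space K)"

definition cost_kernels :: "'x::topological_space set \<Rightarrow> nat \<Rightarrow> ('x \<times> nat \<Rightarrow> real measure) set" where
  "cost_kernels X K = (context_space X \<Otimes>\<^sub>M action_space K) \<rightarrow>\<^sub>M prob_algebra cost_space"

definition coverage ::
    "'x measure \<Rightarrow> nat \<Rightarrow> ('x \<Rightarrow> nat measure) \<Rightarrow> ('x \<Rightarrow> nat measure) \<Rightarrow> bool" where
  "coverage \<nu> K \<pi> \<pi>0 \<longleftrightarrow>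
     (AE x in \<nu>. \<forall>a\<in>{1..K}. measure (\<pi> x) {a} > 0 \<longrightarrow> measure (\<pi>0 x) {a} > 0)"

definition mean_cost :: "('x \<times> nat \<Rightarrow> real measure) \<Rightarrow> 'x \<Rightarrow> nat \<Rightarrow> real" where
  "mean_cost p x a = (\<integral>c. c \<partial>p (x, a))"

definition risk ::
    "'x measure \<Rightarrow> ('x \<times> nat \<Rightarrow> real measure) \<Rightarrow> ('x \<Rightarrow> nat measure) \<Rightarrow> real" where
  "risk \<nu> p \<pi> = (\<integral>x. (\<integral>a. mean_cost p x a \<partial>\<pi> x) \<partial>\<nu>)"

definition logging_dist ::
    "'x::topological_space set \<Rightarrow> nat \<Rightarrow> 'x measure \<Rightarrow> ('x \<times> nat \<Rightarrow> real measure)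
      \<Rightarrow> ('x \<Rightarrow> nat measure) \<Rightarrow> ('x \<times> nat \<times> real) measure" where
  "logging_dist X K \<nu> p \<pi>0 =
     \<nu> \<bind> (\<lambda>x. \<pi>0 x \<bind> (\<lambda>a. p (x, a) \<bind> (\<lambda>c. return (sample_space X K) (x, a, c))))"

definition data_dist ::
    "'x::topological_space set \<Rightarrow> nat \<Rightarrow> 'x measure \<Rightarrow> ('x \<times> nat \<Rightarrow> real measure)
      \<Rightarrow> ('x \<Rightarrow> nat measure) \<Rightarrow> nat \<Rightarrow> (nat \<Rightarrow> 'x \<times> nat \<times> real) measure" where
  "data_dist X K \<nu> p \<pi>0 n = Pi\<^sub>M {1..n} (\<lambda>_. logging_dist X K \<nu> p \<pi>0)"

text \<open>Actions with \<open>measure (\<pi>0 x) {a} = 0\<close>, where the quotient is \<open>0\<close> by convention, are logged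
  with probability zero.\<close>

definition weight :: "('x \<Rightarrow> nat measure) \<Rightarrow> ('x \<Rightarrow> nat measure) \<Rightarrow> 'x \<Rightarrow> nat \<Rightarrow> real" where
  "weight \<pi> \<pi>0 x a = measure (\<pi> x) {a} / measure (\<pi>0 x) {a}"

definition ls_estimator ::
    "('x \<Rightarrow> nat measure) \<Rightarrow> ('x \<Rightarrow> nat measure) \<Rightarrow> real \<Rightarrow> nat
      \<Rightarrow> (nat \<Rightarrow> 'x \<times> nat \<times> real) \<Rightarrow> real" where
  "ls_estimator \<pi> \<pi>0 l n D =
     (if l = 0
      then (1 / real n) * (\<Sum>i=1..n. case D i of (x, a, c) \<Rightarrow> weight \<pi> \<pi>0 x a * c)
      else - (1 / real n) *
             (\<Sum>i=1..n. case D i of (x, a, c) \<Rightarrow> (1 / l) * ln (1 - l * weight \<pi> \<pi>0 x a * c)))"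

definition ls_mean ::
    "'x::topological_space set \<Rightarrow> nat \<Rightarrow> 'x measure \<Rightarrow> ('x \<times> nat \<Rightarrow> real measure)
      \<Rightarrow> ('x \<Rightarrow> nat measure) \<Rightarrow> ('x \<Rightarrow> nat measure) \<Rightarrow> real \<Rightarrow> nat \<Rightarrow> real" where
  "ls_mean X K \<nu> p \<pi> \<pi>0 l n = (\<integral>D. ls_estimator \<pi> \<pi>0 l n D \<partial>data_dist X K \<nu> p \<pi>0 n)"

definition ls_bias ::
    "'x::topological_space set \<Rightarrow> nat \<Rightarrow> 'x measure \<Rightarrow> ('x \<times> nat \<Rightarrow> real measure)
      \<Rightarrow> ('x \<Rightarrow> nat measure) \<Rightarrow> ('x \<Rightarrow> nat measure) \<Rightarrow> real \<Rightarrow> nat \<Rightarrow> real" where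
  "ls_bias X K \<nu> p \<pi> \<pi>0 l n = ls_mean X K \<nu> p \<pi> \<pi>0 l n - risk \<nu> p \<pi>"

text \<open>For \<open>l = 0\<close> the variance and the expectation \<open>\<S>\<^sub>l(\<pi>)\<close> may be infinite, so both are
  extended nonnegative integrals; \<open>0 * \<infinity> = 0\<close> in \<^typ>\<open>ennreal\<close> is the intended reading of
  \<open>l * \<S>\<^sub>l(\<pi>)\<close> at \<open>l = 0\<close>.\<close>

definition ls_variance ::
    "'x::topological_space set \<Rightarrow> nat \<Rightarrow> 'x measure \<Rightarrow> ('x \<times> nat \<Rightarrow> real measure)
      \<Rightarrow> ('x \<Rightarrow> nat measure) \<Rightarrow> ('x \<Rightarrow> nat measure) \<Rightarrow> real \<Rightarrow> nat \<Rightarrow> ennreal" where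
  "ls_variance X K \<nu> p \<pi> \<pi>0 l n =
     (\<integral>\<^sup>+D. ennreal ((ls_estimator \<pi> \<pi>0 l n D - ls_mean X K \<nu> p \<pi> \<pi>0 l n)\<^sup>2)
        \<partial>data_dist X K \<nu> p \<pi>0 n)"

definition ls_S ::
    "'x::topological_space set \<Rightarrow> nat \<Rightarrow> 'x measure \<Rightarrow> ('x \<times> nat \<Rightarrow> real measure)
      \<Rightarrow> ('x \<Rightarrow> nat measure) \<Rightarrow> ('x \<Rightarrow> nat measure) \<Rightarrow> real \<Rightarrow> ennreal" where
  "ls_S X K \<nu> p \<pi> \<pi>0 l =
     (\<integral>\<^sup>+(x, a, c). ennreal ((weight \<pi> \<pi>0 x a * c)\<^sup>2 / (1 - l * weight \<pi> \<pi>0 x a * c))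
        \<partial>logging_dist X K \<nu> p \<pi>0)"


subsection \<open>Well-definedness of the expectations\<close>

context
  fixes X :: "'x::{topological_space} set" and K :: nat and \<nu> p \<pi> \<pi>0
  assumes nu: "\<nu> \<in> space (prob_algebra (context_space X))"
    and p: "p \<in> cost_kernels X K"
    and pi: "\<pi> \<in> policies X K"
    and pi0: "\<pi>0 \<in> policies X K"
begin

lemma sets_nu [measurable_cong]: "sets \<nu> = sets (context_space X)"
  using nu by (simp add: space_prob_algebra)

lemma prob_space_nu: "prob_space \<nu>"
  using nu by (simp add: space_prob_algebra)

lemma pi_measurable [measurable]:
  "\<pi> \<in> context_space X \<rightarrow>\<^sub>M prob_algebra (action_space K)"
  "\<pi>0 \<in> context_space X \<rightarrow>\<^sub>M prob_algebra (action_space K)"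
  using pi pi0 by (auto simp: policies_def)

lemma p_measurable [measurable]:
  "p \<in> context_space X \<Otimes>\<^sub>M action_space K \<rightarrow>\<^sub>M prob_algebra cost_space"
  using p by (auto simp: cost_kernels_def)

lemma logging_kernels:
  "(\<lambda>x. \<pi>0 x \<bind> (\<lambda>a. p (x, a) \<bind> (\<lambda>c. return (sample_space X K) (x, a, c))))
     \<in> context_space X \<rightarrow>\<^sub>M prob_algebra (sample_space X K)"
  by measurable

lemma logging_dist_in_space:
  "logging_dist X K \<nu> p \<pi>0 \<in> space (prob_algebra (sample_space X K))"
proof -
  have "(\<lambda>_::unit. logging_dist X K \<nu> p \<pi>0) \<in> count_space UNIV \<rightarrow>\<^sub>M prob_algebra (sample_space X K)"
    unfolding logging_dist_def
    by (rule measurable_bind_prob_space[OF measurable_const[OF nu] logging_kernels])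
  from measurable_space[OF this, of "()"] show ?thesis by simp
qed

lemma prob_space_logging: "prob_space (logging_dist X K \<nu> p \<pi>0)"
  using logging_dist_in_space unfolding space_prob_algebra by blast

lemma sets_logging [measurable_cong]:
  "sets (logging_dist X K \<nu> p \<pi>0) = sets (sample_space X K)"
  using logging_dist_in_space unfolding space_prob_algebra by blast

lemma weight_measurable [measurable]:
  "(\<lambda>(x, a). weight \<pi> \<pi>0 x a) \<in> borel_measurable (context_space X \<Otimes>\<^sub>M action_space K)"
proof -
  have "(\<lambda>z. (\<lambda>a z. weight \<pi> \<pi>0 (fst z) a) (snd z) z)
      \<in> borel_measurable (context_space X \<Otimes>\<^sub>M action_space K)"
  proof (rule measurable_compose_countable'[where I="{1..K}"])
    fix a assume a: "a \<in> {1..K}"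
    have [measurable]: "(\<lambda>x. measure (\<rho> x) {a}) \<in> borel_measurable (context_space X)"
      if "\<rho> \<in> context_space X \<rightarrow>\<^sub>M prob_algebra (action_space K)" for \<rho>
      using measurable_compose[OF measurable_prob_algebraD[OF that] measurable_measure_subprob_algebra] a
      by auto
    note [measurable] = this[OF pi_measurable(1)] this[OF pi_measurable(2)]
    show "(\<lambda>z. weight \<pi> \<pi>0 (fst z) a) \<in> borel_measurable (context_space X \<Otimes>\<^sub>M action_space K)"
      unfolding weight_def by measurable
  qed auto
  then show ?thesis by (simp add: case_prod_beta')
qed

lemma cost_measurable [measurable]: "(\<lambda>c. c) \<in> borel_measurable cost_space"
  by (auto intro: measurable_restrict_space1)

lemma weighted_cost_measurable:
  "(\<lambda>(x, a, c). weight \<pi> \<pi>0 x a * c) \<in> borel_measurable (sample_space X K)"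
proof -
  have [measurable]: "(\<lambda>z. fst (snd z)) \<in> sample_space X K \<rightarrow>\<^sub>M action_space K"
    "(\<lambda>z. snd (snd z)) \<in> sample_space X K \<rightarrow>\<^sub>M cost_space"
    by measurable
  have 1: "(\<lambda>z. (\<lambda>(x, a). weight \<pi> \<pi>0 x a) (fst z, fst (snd z))) \<in> borel_measurable (sample_space X K)"
    by measurable
  have 2: "(\<lambda>z. snd (snd z)) \<in> borel_measurable (sample_space X K)"
    by (rule measurable_compose[OF _ cost_measurable]) measurable
  show ?thesis using borel_measurable_times[OF 1 2] by (simp add: case_prod_beta')
qed

lemma weight_nonneg: "0 \<le> weight \<pi> \<pi>0 x a"
  by (simp add: weight_def)

lemma weighted_cost_integrable:
  "integrable (logging_dist X K \<nu> p \<pi>0) (\<lambda>(x, a, c). weight \<pi> \<pi>0 x a * c)"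
proof (rule integrableI_bounded)
  show "(\<lambda>(x, a, c). weight \<pi> \<pi>0 x a * c) \<in> borel_measurable (logging_dist X K \<nu> p \<pi>0)"
    using weighted_cost_measurable unfolding measurable_cong_sets[OF sets_logging refl] .
  let ?f = "\<lambda>z. ennreal (norm ((\<lambda>(x, a, c). weight \<pi> \<pi>0 x a * c) z))"
  have fm [measurable]: "?f \<in> borel_measurable (sample_space X K)"
    using weighted_cost_measurable by measurable
  have kern: "(\<lambda>x. \<pi>0 x \<bind> (\<lambda>a. p (x, a) \<bind> (\<lambda>c. return (sample_space X K) (x, a, c))))
     \<in> \<nu> \<rightarrow>\<^sub>M subprob_algebra (sample_space X K)"
    using measurable_prob_algebraD[OF logging_kernels] unfolding measurable_cong_sets[OF sets_nu refl] .
  have inner: "(\<integral>\<^sup>+z. ?f z \<partial>(\<pi>0 x \<bind> (\<lambda>a. p (x, a) \<bind> (\<lambda>c. return (sample_space X K) (x, a, c))))) \<le> 1"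
    if x: "x \<in> space (context_space X)" for x
  proof -
    have pi0x: "\<pi>0 x \<in> space (prob_algebra (action_space K))"
      "\<pi> x \<in> space (prob_algebra (action_space K))"
      using measurable_space[OF pi_measurable(2) x] measurable_space[OF pi_measurable(1) x] by auto
    then have sets_pi0x: "sets (\<pi>0 x) = sets (action_space K)" and sets_pix: "sets (\<pi> x) = sets (action_space K)"
      and ps: "prob_space (\<pi>0 x)" "prob_space (\<pi> x)"
      by (auto simp: space_prob_algebra)
    interpret P0: prob_space "\<pi>0 x" by fact
    interpret P1: prob_space "\<pi> x" by fact
    have sp: "space (\<pi>0 x) = {1..K}" "space (\<pi> x) = {1..K}"
      using sets_eq_imp_space_eq[OF sets_pi0x] sets_eq_imp_space_eq[OF sets_pix] by auto
    have [measurable]: "(\<lambda>a. p (x, a)) \<in> action_space K \<rightarrow>\<^sub>M prob_algebra cost_space"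
      by (rule measurable_compose[OF measurable_Pair1'[OF x] p_measurable])
    have k1: "(\<lambda>a. p (x, a) \<bind> (\<lambda>c. return (sample_space X K) (x, a, c)))
        \<in> action_space K \<rightarrow>\<^sub>M prob_algebra (sample_space X K)"
      using x by measurable
    have k1': "(\<lambda>a. p (x, a) \<bind> (\<lambda>c. return (sample_space X K) (x, a, c)))
        \<in> \<pi>0 x \<rightarrow>\<^sub>M subprob_algebra (sample_space X K)"
      using measurable_prob_algebraD[OF k1] unfolding measurable_cong_sets[OF sets_pi0x refl] .
    have "(\<integral>\<^sup>+z. ?f z \<partial>(p (x, a) \<bind> (\<lambda>c. return (sample_space X K) (x, a, c)))) \<le> ennreal (weight \<pi> \<pi>0 x a)"
      if a: "a \<in> {1..K}" for a
    proof -
      have pxa: "p (x, a) \<in> space (prob_algebra cost_space)"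
        using measurable_space[OF p_measurable, of "(x, a)"] x a by (auto simp: space_pair_measure)
      then have sets_pxa: "sets (p (x, a)) = sets cost_space" and psp: "prob_space (p (x, a))"
        by (auto simp: space_prob_algebra)
      have spc: "space (p (x, a)) = {-1..0}"
        using sets_eq_imp_space_eq[OF sets_pxa] by (simp add: space_restrict_space)
      have "(\<lambda>c. return (sample_space X K) (x, a, c)) \<in> cost_space \<rightarrow>\<^sub>M subprob_algebra (sample_space X K)"
        by (rule measurable_compose[OF _ return_measurable])
          (intro measurable_Pair measurable_const measurable_ident_sets refl, use x a in auto)
      then have k2: "(\<lambda>c. return (sample_space X K) (x, a, c)) \<in> p (x, a) \<rightarrow>\<^sub>M subprob_algebra (sample_space X K)"
        unfolding measurable_cong_sets[OF sets_pxa refl] .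
      have "(\<integral>\<^sup>+z. ?f z \<partial>(p (x, a) \<bind> (\<lambda>c. return (sample_space X K) (x, a, c))))
          = (\<integral>\<^sup>+c. (\<integral>\<^sup>+z. ?f z \<partial>return (sample_space X K) (x, a, c)) \<partial>p (x, a))"
        by (rule nn_integral_bind[OF fm k2])
      also have "\<dots> \<le> (\<integral>\<^sup>+c. ennreal (weight \<pi> \<pi>0 x a) \<partial>p (x, a))"
      proof (rule nn_integral_mono)
        fix c assume "c \<in> space (p (x, a))"
        then have c: "c \<in> {-1..0}" by (simp add: spc)
        have "(\<integral>\<^sup>+z. ?f z \<partial>return (sample_space X K) (x, a, c)) = ?f (x, a, c)"
          using x a c
          by (intro nn_integral_return[OF _ fm]) (auto simp: space_pair_measure space_restrict_space)
        also have "\<dots> \<le> ennreal (weight \<pi> \<pi>0 x a)"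
          using c mult_left_le[of "\<bar>c\<bar>" "weight \<pi> \<pi>0 x a"] weight_nonneg[of x a]
          by (auto simp: abs_mult intro!: ennreal_leI)
        finally show "(\<integral>\<^sup>+z. ?f z \<partial>return (sample_space X K) (x, a, c)) \<le> ennreal (weight \<pi> \<pi>0 x a)" .
      qed
      also have "\<dots> = ennreal (weight \<pi> \<pi>0 x a)"
        using prob_space.emeasure_space_1[OF psp] by simp
      finally show ?thesis .
    qed
    then have "(\<integral>\<^sup>+a. (\<integral>\<^sup>+z. ?f z \<partial>(p (x, a) \<bind> (\<lambda>c. return (sample_space X K) (x, a, c)))) \<partial>\<pi>0 x)
        \<le> (\<integral>\<^sup>+a. ennreal (weight \<pi> \<pi>0 x a) \<partial>\<pi>0 x)"
      by (intro nn_integral_mono) (simp add: sp)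
    also have "\<dots> = (\<Sum>a\<in>{1..K}. ennreal (weight \<pi> \<pi>0 x a) * emeasure (\<pi>0 x) {a})"
    proof -
      have "\<pi>0 x = point_measure {1..K} (\<lambda>a. emeasure (\<pi>0 x) {a})"
        by (rule measure_eqI_finite[of _ "{1..K}"])
          (auto simp: sets_pi0x sets_point_measure emeasure_point_measure_finite)
      then have "(\<integral>\<^sup>+a. ennreal (weight \<pi> \<pi>0 x a) \<partial>\<pi>0 x)
          = (\<integral>\<^sup>+a. ennreal (weight \<pi> \<pi>0 x a) \<partial>point_measure {1..K} (\<lambda>a. emeasure (\<pi>0 x) {a}))"
        by simp
      also have "\<dots> = (\<Sum>a\<in>{1..K}. emeasure (\<pi>0 x) {a} * ennreal (weight \<pi> \<pi>0 x a))"
        by (subst nn_integral_point_measure_finite) auto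
      finally show ?thesis by (simp add: mult.commute)
    qed
    also have "\<dots> \<le> (\<Sum>a\<in>{1..K}. emeasure (\<pi> x) {a})"
    proof (rule sum_mono)
      fix a
      have "weight \<pi> \<pi>0 x a * measure (\<pi>0 x) {a} \<le> measure (\<pi> x) {a}"
        by (simp add: weight_def)
      then have "ennreal (weight \<pi> \<pi>0 x a * measure (\<pi>0 x) {a}) \<le> ennreal (measure (\<pi> x) {a})"
        by (rule ennreal_leI)
      then show "ennreal (weight \<pi> \<pi>0 x a) * emeasure (\<pi>0 x) {a} \<le> emeasure (\<pi> x) {a}"
        by (simp only: P0.emeasure_eq_measure P1.emeasure_eq_measure ennreal_mult[OF weight_nonneg measure_nonneg])
    qed
    also have "\<dots> = emeasure (\<pi> x) {1..K}"
      by (intro emeasure_eq_sum_singleton[symmetric]) (auto simp: sets_pix)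
    also have "\<dots> = 1"
      using prob_space.emeasure_space_1[OF ps(2)] by (simp add: sp)
    finally show ?thesis
      unfolding nn_integral_bind[OF fm k1'] .
  qed
  have "(\<integral>\<^sup>+z. ?f z \<partial>logging_dist X K \<nu> p \<pi>0)
      = (\<integral>\<^sup>+x. (\<integral>\<^sup>+z. ?f z \<partial>(\<pi>0 x \<bind> (\<lambda>a. p (x, a) \<bind> (\<lambda>c. return (sample_space X K) (x, a, c))))) \<partial>\<nu>)"
    unfolding logging_dist_def by (rule nn_integral_bind[OF fm kern])
  also have "\<dots> \<le> (\<integral>\<^sup>+x. 1 \<partial>\<nu>)"
    by (intro nn_integral_mono inner) (simp add: sets_eq_imp_space_eq[OF sets_nu])
  also have "\<dots> = 1"
    using prob_space.emeasure_space_1[OF prob_space_nu] by simp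
  finally show "(\<integral>\<^sup>+z. ?f z \<partial>logging_dist X K \<nu> p \<pi>0) < \<infinity>"
    by (rule order.strict_trans1) simp
qed

lemma logging_cost_nonpos: "AE z in logging_dist X K \<nu> p \<pi>0. snd (snd z) \<le> 0"
  by (rule AE_I2)
    (auto simp: sets_eq_imp_space_eq[OF sets_logging] space_pair_measure space_restrict_space)

lemma log_weighted_cost_integrable:
  assumes "l > 0"
  shows "integrable (logging_dist X K \<nu> p \<pi>0)
           (\<lambda>(x, a, c). (1 / l) * ln (1 - l * weight \<pi> \<pi>0 x a * c))"
proof (rule Bochner_Integration.integrable_bound[OF weighted_cost_integrable])
  have "(\<lambda>z. (1 / l) * ln (1 - l * (\<lambda>(x, a, c). weight \<pi> \<pi>0 x a * c) z))
      \<in> borel_measurable (sample_space X K)"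
    using weighted_cost_measurable by measurable
  then show "(\<lambda>(x, a, c). (1 / l) * ln (1 - l * weight \<pi> \<pi>0 x a * c))
      \<in> borel_measurable (logging_dist X K \<nu> p \<pi>0)"
    unfolding measurable_cong_sets[OF sets_logging refl] by (simp add: case_prod_beta' mult.assoc)
  have "norm ((1 / l) * ln (1 - l * weight \<pi> \<pi>0 x a * c)) \<le> norm (weight \<pi> \<pi>0 x a * c)"
    if "c \<le> 0" for x a c
  proof -
    define y where "y = - (weight \<pi> \<pi>0 x a * c)"
    have y: "0 \<le> y" using that weight_nonneg[of x a] by (simp add: y_def mult_nonneg_nonpos)
    have e: "1 - l * weight \<pi> \<pi>0 x a * c = 1 + l * y" by (simp add: y_def)
    have "0 \<le> ln (1 + l * y)" "ln (1 + l * y) \<le> l * y"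
      using y assms by (auto intro!: ln_add_one_self_le_self)
    then have "\<bar>(1 / l) * ln (1 + l * y)\<bar> \<le> y"
      using assms by (simp add: field_simps)
    moreover have "norm (weight \<pi> \<pi>0 x a * c) = y"
      using y by (simp add: y_def)
    ultimately show ?thesis by (simp only: e real_norm_def)
  qed
  then show "AE z in logging_dist X K \<nu> p \<pi>0.
      norm ((\<lambda>(x, a, c). (1 / l) * ln (1 - l * weight \<pi> \<pi>0 x a * c)) z)
        \<le> norm ((\<lambda>(x, a, c). weight \<pi> \<pi>0 x a * c) z)"
    using logging_cost_nonpos by (auto simp: case_prod_beta')
qed

lemma ls_estimator_integrable:
  assumes "l \<ge> 0"
  shows "integrable (data_dist X K \<nu> p \<pi>0 n) (ls_estimator \<pi> \<pi>0 l n)"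
proof -
  let ?L = "logging_dist X K \<nu> p \<pi>0"
  have comp: "integrable (data_dist X K \<nu> p \<pi>0 n) (\<lambda>D. g (D i))"
    if i: "i \<in> {1..n}" and g: "integrable ?L g" for i and g :: "'x \<times> nat \<times> real \<Rightarrow> real"
  proof -
    have "distr (data_dist X K \<nu> p \<pi>0 n) ?L (\<lambda>D. D i) = ?L"
      unfolding data_dist_def
      using distr_PiM_component[of "{1..n}" "\<lambda>_. ?L" i] prob_space_logging i by simp
    with g have "integrable (distr (data_dist X K \<nu> p \<pi>0 n) ?L (\<lambda>D. D i)) g" by simp
    then show ?thesis
      by (rule integrable_distr[rotated]) (use i in \<open>simp add: data_dist_def\<close>)
  qed
  show ?thesis
  proof (cases "l = 0")
    case True
    then show ?thesis
      unfolding ls_estimator_def using comp[OF _ weighted_cost_integrable]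
      by (auto intro!: Bochner_Integration.integrable_sum integrable_mult_right)
  next
    case False
    then show ?thesis
      unfolding ls_estimator_def
      using comp[OF _ log_weighted_cost_integrable[of l]] assms
      by (auto simp del: mult_minus_left simp flip: mult_minus_left
          intro!: Bochner_Integration.integrable_sum integrable_mult_right)
  qed
qed

lemma mean_cost_bounds:
  assumes "x \<in> X" "a \<in> {1..K}"
  shows "integrable (p (x, a)) (\<lambda>c. c)" and "mean_cost p x a \<in> {-1..0}"
proof -
  have "p (x, a) \<in> space (prob_algebra cost_space)"
    using measurable_space[OF p_measurable, of "(x, a)"] assms
    by (auto simp: space_pair_measure space_restrict_space)
  then have sets_pxa: "sets (p (x, a)) = sets cost_space" and "prob_space (p (x, a))"
    by (auto simp: space_prob_algebra)
  then interpret P: prob_space "p (x, a)" by simp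
  have spc: "space (p (x, a)) = {-1..0}"
    using sets_eq_imp_space_eq[OF sets_pxa] by (simp add: space_restrict_space)
  have "(\<lambda>c. c) \<in> borel_measurable (p (x, a))"
    using cost_measurable unfolding measurable_cong_sets[OF sets_pxa refl] .
  then show int: "integrable (p (x, a)) (\<lambda>c. c)"
    by (intro P.integrable_const_bound[where B=1] AE_I2) (auto simp: spc)
  have "-1 \<le> (\<integral>c. c \<partial>p (x, a))"
    by (rule P.integral_ge_const[OF int AE_I2]) (simp add: spc)
  moreover have "(\<integral>c. c \<partial>p (x, a)) \<le> 0"
    by (rule P.integral_le_const[OF int AE_I2]) (simp add: spc)
  ultimately show "mean_cost p x a \<in> {-1..0}" by (simp add: mean_cost_def)
qed

lemma risk_integrable:
  shows "x \<in> X \<Longrightarrow> integrable (\<pi> x) (mean_cost p x)"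
    and "integrable \<nu> (\<lambda>x. \<integral>a. mean_cost p x a \<partial>\<pi> x)"
proof -
  have inner: "integrable (\<pi> x) (mean_cost p x) \<and> (\<integral>a. mean_cost p x a \<partial>\<pi> x) \<in> {-1..0}"
    if x: "x \<in> X" for x
  proof -
    have "\<pi> x \<in> space (prob_algebra (action_space K))"
      using measurable_space[OF pi_measurable(1)] x by (auto simp: space_restrict_space)
    then have sets_pix: "sets (\<pi> x) = sets (action_space K)" and "prob_space (\<pi> x)"
      by (auto simp: space_prob_algebra)
    then interpret Q: prob_space "\<pi> x" by simp
    have sp: "space (\<pi> x) = {1..K}"
      using sets_eq_imp_space_eq[OF sets_pix] by simp
    have b: "-1 \<le> mean_cost p x a" "mean_cost p x a \<le> 0" if "a \<in> {1..K}" for a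
      using mean_cost_bounds(2)[OF x that] by auto
    have m: "mean_cost p x \<in> borel_measurable (\<pi> x)"
      unfolding measurable_cong_sets[OF sets_pix refl] by simp
    have int: "integrable (\<pi> x) (mean_cost p x)"
    proof (rule Q.integrable_const_bound[where B=1, OF AE_I2 m])
      fix a assume "a \<in> space (\<pi> x)"
      with b[of a] show "norm (mean_cost p x a) \<le> 1" by (simp add: sp)
    qed
    have "-1 \<le> (\<integral>a. mean_cost p x a \<partial>\<pi> x)"
      by (rule Q.integral_ge_const[OF int AE_I2]) (use b sp in auto)
    moreover have "(\<integral>a. mean_cost p x a \<partial>\<pi> x) \<le> 0"
      by (rule Q.integral_le_const[OF int AE_I2]) (use b sp in auto)
    ultimately show ?thesis using int by simp
  qed
  then show "x \<in> X \<Longrightarrow> integrable (\<pi> x) (mean_cost p x)" by blast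
  interpret N: prob_space \<nu> by (rule prob_space_nu)
  have "(\<lambda>z. \<integral>c. c \<partial>p z) \<in> borel_measurable (context_space X \<Otimes>\<^sub>M action_space K)"
    by (rule measurable_compose[OF measurable_prob_algebraD[OF p_measurable]
          integral_measurable_subprob_algebra[OF cost_measurable]])
  then have mc: "(\<lambda>(x, a). mean_cost p x a) \<in> borel_measurable (context_space X \<Otimes>\<^sub>M action_space K)"
    by (simp add: mean_cost_def case_prod_beta')
  have "(\<lambda>x. \<integral>a. mean_cost p x a \<partial>\<pi> x) \<in> borel_measurable (context_space X)"
  proof (subst measurable_cong)
    fix x assume "x \<in> space (context_space X)"
    then have x: "x \<in> X" by (simp add: space_restrict_space)
    have "\<pi> x \<in> space (prob_algebra (action_space K))"
      using measurable_space[OF pi_measurable(1)] x by (auto simp: space_restrict_space)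
    then have sets_pix: "sets (\<pi> x) = sets (action_space K)"
      by (auto simp: space_prob_algebra)
    have "AE a in \<pi> x. 0 \<le> - mean_cost p x a"
      using mean_cost_bounds(2)[OF x] sets_eq_imp_space_eq[OF sets_pix] by (intro AE_I2) auto
    moreover have "(\<lambda>a. - mean_cost p x a) \<in> borel_measurable (\<pi> x)"
      unfolding measurable_cong_sets[OF sets_pix refl] by simp
    ultimately have "(\<integral>a. - mean_cost p x a \<partial>\<pi> x) = enn2real (\<integral>\<^sup>+a. ennreal (- mean_cost p x a) \<partial>\<pi> x)"
      by (intro integral_eq_nn_integral)
    then show "(\<integral>a. mean_cost p x a \<partial>\<pi> x) = - enn2real (\<integral>\<^sup>+a. ennreal (- mean_cost p x a) \<partial>\<pi> x)"
      by simp
  next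
    have "(\<lambda>z. ennreal (- (\<lambda>(x, a). mean_cost p x a) z)) \<in> borel_measurable (context_space X \<Otimes>\<^sub>M action_space K)"
      using mc by measurable
    then have "(\<lambda>(x, a). ennreal (- mean_cost p x a)) \<in> borel_measurable (context_space X \<Otimes>\<^sub>M action_space K)"
      by (simp only: case_prod_beta')
    from nn_integral_measurable_subprob_algebra2[OF this measurable_prob_algebraD[OF pi_measurable(1)]]
    show "(\<lambda>x. - enn2real (\<integral>\<^sup>+a. ennreal (- mean_cost p x a) \<partial>\<pi> x)) \<in> borel_measurable (context_space X)"
      by measurable
  qed
  then have m: "(\<lambda>x. \<integral>a. mean_cost p x a \<partial>\<pi> x) \<in> borel_measurable \<nu>"
    unfolding measurable_cong_sets[OF sets_nu refl] .
  have "space \<nu> = X"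
    using sets_eq_imp_space_eq[OF sets_nu] by (simp add: space_restrict_space)
  then show "integrable \<nu> (\<lambda>x. \<integral>a. mean_cost p x a \<partial>\<pi> x)"
    using inner by (intro N.integrable_const_bound[where B=1, OF AE_I2 m]) force
qed

end

end

theory Submission
  imports Defs
begin

text \<open>
  Put \<open>y = - w\<^sub>\<pi>(x, a) c \<ge> 0\<close>. By coverage the importance weights are exact, so \<open>\<E>[y] = - R(\<pi>)\<close>, and the
  estimator is the empirical mean of i.i.d. copies of \<open>- ln (1 + \<lambda> y) / \<lambda>\<close>. With \<open>u = \<lambda> y\<close>, the bias
  bounds are \<open>u / (1 + u) \<le> ln (1 + u) \<le> u\<close> integrated, and the variance bounds are
  \<open>(ln (1 + u))\<^sup>2 \<le> u\<^sup>2 / (1 + u) \<le> u\<close> integrated, the variance of the mean being at most the second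
  moment of a single term divided by \<open>n\<close>.
\<close>

section \<open>Elementary inequalities for the logarithm\<close>

text \<open>Both sides vanish at \<open>t = 1\<close>, and the difference has derivative
  \<open>1 - 2 / t + 1 / t^2\<close>, a perfect square.\<close>

lemma ln_le_diff_inverse:
  fixes t :: real
  assumes "t \<ge> 1"
  shows "2 * ln t \<le> t - 1 / t"
proof -
  have "1 - 1 / 1 - 2 * ln 1 \<le> t - 1 / t - 2 * ln t"
  proof (rule DERIV_nonneg_imp_nondecreasing[OF assms])
    fix x :: real
    assume x: "1 \<le> x" "x \<le> t"
    have "((\<lambda>t. t - 1 / t - 2 * ln t) has_real_derivative (1 - 1 / x)\<^sup>2) (at x)"
      using x by (auto intro!: derivative_eq_intros simp: power2_eq_square field_simps)
    then show "\<exists>y. ((\<lambda>t. t - 1 / t - 2 * ln t) has_real_derivative y) (at x) \<and> 0 \<le> y"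
      by (intro exI[of _ "(1 - 1 / x)\<^sup>2"]) simp
  qed
  then show ?thesis by simp
qed

text \<open>The previous inequality at \<open>t = sqrt (1 + u)\<close> gives
  \<open>ln (1 + u) <= u / sqrt (1 + u)\<close>; both sides are nonnegative, so squaring preserves
  the order.\<close>

lemma ln_one_plus_squared_le:
  fixes u :: real
  assumes "u \<ge> 0"
  shows "(ln (1 + u))\<^sup>2 \<le> u\<^sup>2 / (1 + u)"
proof -
  define t where "t = sqrt (1 + u)"
  have t: "t \<ge> 1" "t\<^sup>2 = 1 + u"
    using assms by (auto simp: t_def)
  have "ln (1 + u) = 2 * ln t"
    using t by (simp flip: t(2) add: ln_realpow)
  also have "\<dots> \<le> t - 1 / t"
    by (rule ln_le_diff_inverse[OF t(1)])
  also have "\<dots> = u / t"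
    using t by (simp add: field_simps power2_eq_square)
  finally have "(ln (1 + u))\<^sup>2 \<le> (u / t)\<^sup>2"
    using assms by (intro power_mono) auto
  then show ?thesis
    using t by (simp add: power_divide)
qed

text \<open>This is \<open>ln s <= s - 1\<close> at the reciprocal
  \<open>s = 1 / (1 + u)\<close>.\<close>

lemma ln_one_plus_ge:
  fixes u :: real
  assumes "u \<ge> 0"
  shows "u / (1 + u) \<le> ln (1 + u)"
proof -
  have "ln (1 / (1 + u)) \<le> 1 / (1 + u) - 1"
    using assms by (intro ln_le_minus_one) auto
  then show ?thesis
    using assms by (simp add: ln_div field_simps)
qed

section \<open>Integration over finite discrete spaces\<close>

text \<open>A measure on a finite discrete space is determined by its atoms, hence is a point
  measure. Applied to the action distributions of policies.\<close>

lemma nn_integral_finite_space: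
  assumes "finite A" and "sets M = sets (count_space A)"
  shows "(\<integral>\<^sup>+a. f a \<partial>M) = (\<Sum>a\<in>A. f a * emeasure M {a})"
proof -
  have "M = point_measure A (\<lambda>a. emeasure M {a})"
    using assms by (intro measure_eqI_finite[of _ A])
      (auto simp: sets_point_measure emeasure_point_measure_finite)
  then have "(\<integral>\<^sup>+a. f a \<partial>M) = (\<integral>\<^sup>+a. f a \<partial>point_measure A (\<lambda>a. emeasure M {a}))"
    by simp
  also have "\<dots> = (\<Sum>a\<in>A. emeasure M {a} * f a)"
    using assms(1) by (subst nn_integral_point_measure_finite) auto
  finally show ?thesis by (simp add: mult.commute)
qed

section \<open>Moments of empirical means under product measures\<close>

context prob_space
begin

text \<open>Every coordinate of the product measure has marginal \<open>M\<close>, so both claims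
  are a change of variables along the projection.\<close>

lemma PiM_component_integral:
  fixes f :: "'a \<Rightarrow> real"
  assumes "i \<in> I" and f: "integrable M f"
  shows "integrable (Pi\<^sub>M I (\<lambda>_. M)) (\<lambda>D. f (D i))"
    and "(\<integral>D. f (D i) \<partial>Pi\<^sub>M I (\<lambda>_. M)) = expectation f"
proof -
  have d: "distr (Pi\<^sub>M I (\<lambda>_. M)) M (\<lambda>D. D i) = M"
    using distr_PiM_component[of I "\<lambda>_. M" i] assms prob_space_axioms by simp
  have m: "(\<lambda>D. D i) \<in> Pi\<^sub>M I (\<lambda>_. M) \<rightarrow>\<^sub>M M"
    using assms by measurable
  show "integrable (Pi\<^sub>M I (\<lambda>_. M)) (\<lambda>D. f (D i))"
    using f d integrable_distr[OF m, of f] by simp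
  show "(\<integral>D. f (D i) \<partial>Pi\<^sub>M I (\<lambda>_. M)) = expectation f"
    using integral_distr[OF m borel_measurable_integrable[OF f]] by (simp add: d)
qed

text \<open>Independence of two distinct coordinates, obtained from Fubini for products with one
  factor per coordinate.\<close>

lemma PiM_component_product:
  fixes f g :: "'a \<Rightarrow> real"
  assumes I: "finite I" and ij: "i \<in> I" "j \<in> I" "i \<noteq> j"
    and f: "integrable M f" and g: "integrable M g"
  shows "integrable (Pi\<^sub>M I (\<lambda>_. M)) (\<lambda>D. f (D i) * g (D j))"
    and "(\<integral>D. f (D i) * g (D j) \<partial>Pi\<^sub>M I (\<lambda>_. M)) = expectation f * expectation g"
proof -
  interpret PP: product_prob_space "\<lambda>_. M" I ..
  \<comment> \<open>The two given functions are padded with the constant 1, so that the product over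
    all of \<open>I\<close> reduces to its factors at \<open>i\<close> and \<open>j\<close>.\<close>
  define h where "h = (\<lambda>k. if k = i then f else if k = j then g else (\<lambda>_. 1))"
  have two: "(\<Prod>k\<in>I. c k) = c i * c j" if "\<And>k. k \<in> I \<Longrightarrow> k \<noteq> i \<Longrightarrow> k \<noteq> j \<Longrightarrow> c k = 1" for c :: "_ \<Rightarrow> real"
  proof -
    have "(\<Prod>k\<in>I. c k) = prod c {i, j}"
      using that ij I by (intro prod.mono_neutral_right) auto
    then show ?thesis using ij by simp
  qed
  have int: "integrable M (h k)" for k
    using f g by (simp add: h_def)
  have e: "(\<lambda>D. \<Prod>k\<in>I. h k (D k)) = (\<lambda>D. f (D i) * g (D j))"
    using ij by (intro ext, subst two) (auto simp: h_def)
  have "(\<Prod>k\<in>I. expectation (h k)) = expectation f * expectation g"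
    using ij by (subst two) (auto simp: h_def prob_space)
  then show "(\<integral>D. f (D i) * g (D j) \<partial>Pi\<^sub>M I (\<lambda>_. M)) = expectation f * expectation g"
    using PP.product_integral_prod[of I h, OF I int] unfolding e by simp
  show "integrable (Pi\<^sub>M I (\<lambda>_. M)) (\<lambda>D. f (D i) * g (D j))"
    using PP.product_integrable_prod[of I h, OF I int] unfolding e .
qed

text \<open>After centering, the square expands into a double sum: off-diagonal terms integrate to 0
  by independence, and each diagonal term contributes one variance.\<close>

lemma variance_sum_PiM:
  fixes f :: "'a \<Rightarrow> real"
  assumes I: "finite I" and f: "integrable M f" and f2: "integrable M (\<lambda>x. (f x)\<^sup>2)"
  shows "integrable (Pi\<^sub>M I (\<lambda>_. M)) (\<lambda>D. ((\<Sum>i\<in>I. f (D i)) - real (card I) * expectation f)\<^sup>2)"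
    and "(\<integral>D. ((\<Sum>i\<in>I. f (D i)) - real (card I) * expectation f)\<^sup>2 \<partial>Pi\<^sub>M I (\<lambda>_. M))
      = real (card I) * variance f"
proof -
  define g where "g = (\<lambda>x. f x - expectation f)"
  have g: "integrable M g" and g0: "expectation g = 0"
    using f by (auto simp: g_def prob_space)
  have g2: "integrable M (\<lambda>x. g x * g x)"
    using f f2 by (simp add: g_def power2_diff flip: power2_eq_square)
  have int: "integrable (Pi\<^sub>M I (\<lambda>_. M)) (\<lambda>D. g (D i) * g (D j))" if "i \<in> I" "j \<in> I" for i j
    using PiM_component_product(1)[OF I that _ g g] PiM_component_integral(1)[OF that(1) g2]
    by (cases "i = j") auto
  have val: "(\<integral>D. g (D i) * g (D j) \<partial>Pi\<^sub>M I (\<lambda>_. M)) = (if i = j then variance f else 0)"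
    if "i \<in> I" "j \<in> I" for i j
    using PiM_component_product(2)[OF I that _ g g] PiM_component_integral(2)[OF that(1) g2] g0
    by (cases "i = j") (auto simp: g_def power2_eq_square)
  have e: "((\<Sum>i\<in>I. f (D i)) - real (card I) * expectation f)\<^sup>2 = (\<Sum>i\<in>I. \<Sum>j\<in>I. g (D i) * g (D j))" for D
    by (simp add: g_def sum_subtractf power2_eq_square flip: sum_product)
  show "integrable (Pi\<^sub>M I (\<lambda>_. M)) (\<lambda>D. ((\<Sum>i\<in>I. f (D i)) - real (card I) * expectation f)\<^sup>2)"
    unfolding e using int by auto
  show "(\<integral>D. ((\<Sum>i\<in>I. f (D i)) - real (card I) * expectation f)\<^sup>2 \<partial>Pi\<^sub>M I (\<lambda>_. M))
      = real (card I) * variance f"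
    unfolding e using I int by (simp add: val)
qed

text \<open>Extended integrals let the bound cover an infinite second moment, which can occur for
  the unsmoothed estimator.\<close>

lemma variance_mean_PiM_le:
  fixes f :: "'a \<Rightarrow> real"
  assumes I: "finite I" "I \<noteq> {}" and f: "integrable M f"
  shows "(\<integral>\<^sup>+D. ennreal (((\<Sum>i\<in>I. f (D i)) / real (card I) - expectation f)\<^sup>2) \<partial>Pi\<^sub>M I (\<lambda>_. M))
    \<le> (\<integral>\<^sup>+x. ennreal ((f x)\<^sup>2) \<partial>M) / of_nat (card I)"
proof (cases "(\<integral>\<^sup>+x. ennreal ((f x)\<^sup>2) \<partial>M) = \<infinity>")
  \<comment> \<open>The right-hand side is infinity divided by a finite number, hence
    infinite.\<close>
  case True
  then show ?thesis
    by (simp add: ennreal_top_divide)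
next
  case False
  let ?n = "real (card I)"
  let ?d = "\<lambda>D. (\<Sum>i\<in>I. f (D i)) - ?n * expectation f"
  have n: "?n > 0" using I by (simp add: card_gt_0_iff)
  have f2: "integrable M (\<lambda>x. (f x)\<^sup>2)"
    using False f by (intro integrableI_nonneg) (auto simp: less_top)
  have "((\<Sum>i\<in>I. f (D i)) / ?n - expectation f)\<^sup>2 = (?d D)\<^sup>2 / ?n\<^sup>2" for D
    using n by (simp add: diff_divide_distrib flip: power_divide)
  then have "(\<integral>\<^sup>+D. ennreal (((\<Sum>i\<in>I. f (D i)) / ?n - expectation f)\<^sup>2) \<partial>Pi\<^sub>M I (\<lambda>_. M))
      = (\<integral>\<^sup>+D. ennreal ((?d D)\<^sup>2 / ?n\<^sup>2) \<partial>Pi\<^sub>M I (\<lambda>_. M))"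
    by simp
  also have "\<dots> = ennreal (\<integral>D. (?d D)\<^sup>2 / ?n\<^sup>2 \<partial>Pi\<^sub>M I (\<lambda>_. M))"
    using variance_sum_PiM(1)[OF I(1) f f2] by (intro nn_integral_eq_integral) auto
  also have "(\<integral>D. (?d D)\<^sup>2 / ?n\<^sup>2 \<partial>Pi\<^sub>M I (\<lambda>_. M)) = variance f / ?n"
    using variance_sum_PiM(2)[OF I(1) f f2] n by (simp add: power2_eq_square)
  \<comment> \<open>The square of the mean is dropped from the variance.\<close>
  also have "ennreal (variance f / ?n) \<le> ennreal (expectation (\<lambda>x. (f x)\<^sup>2) / ?n)"
    using n by (intro ennreal_leI divide_right_mono) (auto simp: variance_eq[OF f f2])
  also have "\<dots> = ennreal (expectation (\<lambda>x. (f x)\<^sup>2)) / of_nat (card I)"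
    using n by (simp add: divide_ennreal ennreal_of_nat_eq_real_of_nat)
  also have "ennreal (expectation (\<lambda>x. (f x)\<^sup>2)) = (\<integral>\<^sup>+x. ennreal ((f x)\<^sup>2) \<partial>M)"
    using f2 by (intro nn_integral_eq_integral[symmetric]) auto
  finally show ?thesis .
qed

end

section \<open>Pointwise bounds on a single summand of the estimator\<close>

text \<open>The outer minus sign of the logarithmic case is absorbed into the summand, so that both
  cases become plain empirical means.\<close>

definition ls_term ::
    "('x \<Rightarrow> nat measure) \<Rightarrow> ('x \<Rightarrow> nat measure) \<Rightarrow> real \<Rightarrow> 'x \<times> nat \<times> real \<Rightarrow> real" where
  "ls_term \<pi> \<pi>0 l = (\<lambda>(x, a, c).
     if l = 0 then weight \<pi> \<pi>0 x a * c else - ((1 / l) * ln (1 - l * weight \<pi> \<pi>0 x a * c)))"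

text \<open>The denominator is written as a cardinality to match \<open>variance_mean_PiM_le\<close>
  with index set \<open>{1..n}\<close>.\<close>

lemma ls_estimator_eq_mean:
  "ls_estimator \<pi> \<pi>0 l n D = (\<Sum>i\<in>{1..n}. ls_term \<pi> \<pi>0 l (D i)) / real (card {1..n})"
  by (auto simp: ls_estimator_def ls_term_def case_prod_beta' sum_negf)

context
  fixes \<pi> \<pi>0 :: "'x \<Rightarrow> nat measure" and l y c :: real and x :: 'x and a :: nat
  assumes l: "l \<ge> 0" and c: "c \<le> 0"
  defines "y \<equiv> - (weight \<pi> \<pi>0 x a * c)"
begin

lemma neg_weighted_cost_nonneg: "y \<ge> 0"
  using c by (simp add: y_def weight_def mult_nonneg_nonpos divide_nonpos_nonneg)

lemma ls_term_eq: "ls_term \<pi> \<pi>0 l (x, a, c) = (if l = 0 then - y else - (ln (1 + l * y) / l))"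
  by (simp add: ls_term_def y_def mult.assoc)

text \<open>Since \<open>ln (1 + u) <= u\<close> at \<open>u = l * y\<close>, smoothing moves the
  nonpositive weighted cost towards 0. This is the source of the nonnegative bias.\<close>

lemma ls_term_ge: "weight \<pi> \<pi>0 x a * c \<le> ls_term \<pi> \<pi>0 l (x, a, c)"
proof (cases "l = 0")
  case False
  have "ln (1 + l * y) \<le> l * y"
    using l neg_weighted_cost_nonneg by (intro ln_add_one_self_le_self) auto
  then have "- y \<le> ls_term \<pi> \<pi>0 l (x, a, c)"
    using False l unfolding ls_term_eq by (simp add: field_simps)
  then show ?thesis by (simp add: y_def mult.assoc)
qed (simp add: ls_term_def)

text \<open>By \<open>ln_one_plus_ge\<close> at \<open>u = l * y\<close>, the gap is at most
  \<open>y - y / (1 + l * y)\<close>, which equals the right-hand side. At \<open>l = 0\<close> both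
  sides are 0.\<close>

lemma ls_term_le:
  "ls_term \<pi> \<pi>0 l (x, a, c) - weight \<pi> \<pi>0 x a * c
    \<le> l * ((weight \<pi> \<pi>0 x a * c)\<^sup>2 / (1 - l * weight \<pi> \<pi>0 x a * c))"
proof (cases "l = 0")
  case False
  have y: "0 \<le> l * y"
    using l neg_weighted_cost_nonneg by simp
  have "l * y / (1 + l * y) / l \<le> ln (1 + l * y) / l"
    using ln_one_plus_ge[OF y] l by (rule divide_right_mono)
  moreover have "y - l * y / (1 + l * y) / l = l * (y\<^sup>2 / (1 + l * y))"
  proof -
    have "y - y / (1 + l * y) = l * (y\<^sup>2 / (1 + l * y))"
      using y by (simp add: field_simps power2_eq_square add_nonneg_eq_0_iff)
    then show ?thesis using False by simp
  qed
  ultimately have "ls_term \<pi> \<pi>0 l (x, a, c) + y \<le> l * (y\<^sup>2 / (1 + l * y))"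
    using False unfolding ls_term_eq by simp
  then show ?thesis by (simp add: y_def mult.assoc)
qed (simp add: ls_term_def)

text \<open>For positive \<open>l\<close> this is \<open>ln_one_plus_squared_le\<close> at
  \<open>u = l * y\<close>, divided by the square of \<open>l\<close>; at \<open>l = 0\<close> it is
  an equality.\<close>

lemma ls_term_squared_le:
  "(ls_term \<pi> \<pi>0 l (x, a, c))\<^sup>2 \<le> (weight \<pi> \<pi>0 x a * c)\<^sup>2 / (1 - l * weight \<pi> \<pi>0 x a * c)"
proof (cases "l = 0")
  case False
  have y: "0 \<le> l * y"
    using l neg_weighted_cost_nonneg by simp
  have "(ln (1 + l * y))\<^sup>2 / l\<^sup>2 \<le> (l * y)\<^sup>2 / (1 + l * y) / l\<^sup>2"
    using ln_one_plus_squared_le[OF y] by (rule divide_right_mono) simp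
  also have "\<dots> = y\<^sup>2 / (1 + l * y)"
    using False by (simp add: power_mult_distrib)
  finally have "(ls_term \<pi> \<pi>0 l (x, a, c))\<^sup>2 \<le> y\<^sup>2 / (1 + l * y)"
    using False unfolding ls_term_eq by (simp add: power_divide)
  then show ?thesis by (simp add: y_def mult.assoc)
qed (simp add: ls_term_def)

text \<open>Since \<open>l * y <= 1 + l * y\<close>, one of the two factors \<open>y\<close> in the
  numerator is absorbed by the denominator. The remaining bound is linear in \<open>y\<close>, hence
  integrable.\<close>

lemma ls_S_integrand_le:
  assumes "l > 0"
  shows "(weight \<pi> \<pi>0 x a * c)\<^sup>2 / (1 - l * weight \<pi> \<pi>0 x a * c) \<le> - (weight \<pi> \<pi>0 x a * c) / l"
proof -
  have "y\<^sup>2 / (1 + l * y) \<le> y / l"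
    using assms neg_weighted_cost_nonneg
    by (simp add: field_simps power2_eq_square add_pos_nonneg)
  then show ?thesis by (simp add: y_def mult.assoc)
qed

end

section \<open>The logging distribution and importance weighting\<close>

locale logged_bandit =
  fixes X :: "'x::topological_space set" and K :: nat and \<nu> :: "'x measure"
    and p :: "'x \<times> nat \<Rightarrow> real measure" and \<pi> \<pi>0 :: "'x \<Rightarrow> nat measure"
  assumes nu: "\<nu> \<in> space (prob_algebra (context_space X))"
    and p: "p \<in> cost_kernels X K"
    and pi: "\<pi> \<in> policies X K"
    and pi0: "\<pi>0 \<in> policies X K"
begin

text \<open>The order is that of the assumptions in the unnamed context where the well-definedness
  lemmas are proved, so that \<open>OF bandit\<close> discharges all four.\<close>

lemmas bandit = nu p pi pi0

abbreviation (input) "L \<equiv> logging_dist X K \<nu> p \<pi>0"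

sublocale L: prob_space L
  by (rule prob_space_logging[OF bandit])

lemma space_nu: "space \<nu> = X"
  using sets_eq_imp_space_eq[OF sets_nu[OF bandit]] by (simp add: space_restrict_space)

lemma policy_sets:
  assumes "x \<in> X"
  shows "sets (\<pi> x) = sets (action_space K)" "sets (\<pi>0 x) = sets (action_space K)"
    "prob_space (\<pi> x)" "prob_space (\<pi>0 x)"
  using measurable_space[OF pi_measurable(1)[OF bandit]] measurable_space[OF pi_measurable(2)[OF bandit]] assms
  by (auto simp: space_restrict_space space_prob_algebra)

lemma cost_sets:
  assumes "x \<in> X" "a \<in> {1..K}"
  shows "sets (p (x, a)) = sets cost_space" "prob_space (p (x, a))" "space (p (x, a)) = {-1..0}"
proof -
  show s: "sets (p (x, a)) = sets cost_space" and "prob_space (p (x, a))"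
    using measurable_space[OF p_measurable[OF bandit], of "(x, a)"] assms
    by (auto simp: space_restrict_space space_prob_algebra space_pair_measure)
  show "space (p (x, a)) = {-1..0}"
    using sets_eq_imp_space_eq[OF s] by (simp add: space_restrict_space)
qed

text \<open>The three nested binds draw context, action and cost in turn; each becomes an integral,
  peeled off from the innermost one outwards.\<close>

lemma nn_integral_logging:
  assumes f: "f \<in> borel_measurable (sample_space X K)"
  shows "(\<integral>\<^sup>+z. f z \<partial>L) = (\<integral>\<^sup>+x. \<integral>\<^sup>+a. \<integral>\<^sup>+c. f (x, a, c) \<partial>p (x, a) \<partial>\<pi>0 x \<partial>\<nu>)"
proof -
  note p_measurable[OF bandit, measurable]
  have kern: "(\<lambda>x. \<pi>0 x \<bind> (\<lambda>a. p (x, a) \<bind> (\<lambda>c. return (sample_space X K) (x, a, c))))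
     \<in> \<nu> \<rightarrow>\<^sub>M subprob_algebra (sample_space X K)"
    using measurable_prob_algebraD[OF logging_kernels[OF bandit]]
    unfolding measurable_cong_sets[OF sets_nu[OF bandit] refl] .
  have inner_a: "(\<integral>\<^sup>+z. f z \<partial>(p (x, a) \<bind> (\<lambda>c. return (sample_space X K) (x, a, c))))
      = (\<integral>\<^sup>+c. f (x, a, c) \<partial>p (x, a))" if x: "x \<in> X" and a: "a \<in> {1..K}" for x a
  proof -
    have "(\<lambda>c. return (sample_space X K) (x, a, c)) \<in> cost_space \<rightarrow>\<^sub>M subprob_algebra (sample_space X K)"
      by (rule measurable_compose[OF _ return_measurable])
        (intro measurable_Pair measurable_const measurable_ident_sets refl,
          use x a in \<open>auto simp: space_restrict_space\<close>)
    then have k: "(\<lambda>c. return (sample_space X K) (x, a, c)) \<in> p (x, a) \<rightarrow>\<^sub>M subprob_algebra (sample_space X K)"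
      unfolding measurable_cong_sets[OF cost_sets(1)[OF x a] refl] .
    show ?thesis
      unfolding nn_integral_bind[OF f k]
      using x a cost_sets(3)[OF x a]
      by (intro nn_integral_cong nn_integral_return[OF _ f])
        (auto simp: space_pair_measure space_restrict_space)
  qed
  have inner_x: "(\<integral>\<^sup>+z. f z \<partial>(\<pi>0 x \<bind> (\<lambda>a. p (x, a) \<bind> (\<lambda>c. return (sample_space X K) (x, a, c)))))
      = (\<integral>\<^sup>+a. \<integral>\<^sup>+c. f (x, a, c) \<partial>p (x, a) \<partial>\<pi>0 x)" if x: "x \<in> X" for x
  proof -
    have x': "x \<in> space (context_space X)" using x by (simp add: space_restrict_space)
    have [measurable]: "(\<lambda>a. p (x, a)) \<in> action_space K \<rightarrow>\<^sub>M prob_algebra cost_space"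
      by (rule measurable_compose[OF measurable_Pair1'[OF x'] p_measurable[OF bandit]])
    have "(\<lambda>a. p (x, a) \<bind> (\<lambda>c. return (sample_space X K) (x, a, c)))
        \<in> action_space K \<rightarrow>\<^sub>M prob_algebra (sample_space X K)"
      using x' by measurable
    then have k: "(\<lambda>a. p (x, a) \<bind> (\<lambda>c. return (sample_space X K) (x, a, c)))
        \<in> \<pi>0 x \<rightarrow>\<^sub>M subprob_algebra (sample_space X K)"
      using measurable_prob_algebraD unfolding measurable_cong_sets[OF policy_sets(2)[OF x] refl] by blast
    show ?thesis
      unfolding nn_integral_bind[OF f k]
      using sets_eq_imp_space_eq[OF policy_sets(2)[OF x]]
      by (intro nn_integral_cong inner_a[OF x]) simp
  qed
  show ?thesis
    unfolding logging_dist_def nn_integral_bind[OF f kern]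
    by (intro nn_integral_cong inner_x) (simp add: space_nu)
qed

text \<open>Change of measure from the behavior policy to the target policy: for almost every
  context, weight times behavior mass is the target mass at each action.\<close>

lemma nn_integral_weighted:
  fixes h :: "'x \<Rightarrow> nat \<Rightarrow> ennreal"
  assumes cov: "coverage \<nu> K \<pi> \<pi>0"
  shows "(\<integral>\<^sup>+x. \<integral>\<^sup>+a. ennreal (weight \<pi> \<pi>0 x a) * h x a \<partial>\<pi>0 x \<partial>\<nu>) = (\<integral>\<^sup>+x. \<integral>\<^sup>+a. h x a \<partial>\<pi> x \<partial>\<nu>)"
proof (rule nn_integral_cong_AE)
  show "AE x in \<nu>. (\<integral>\<^sup>+a. ennreal (weight \<pi> \<pi>0 x a) * h x a \<partial>\<pi>0 x) = (\<integral>\<^sup>+a. h x a \<partial>\<pi> x)"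
    using cov[unfolded coverage_def] AE_space
  proof eventually_elim
    case (elim x)
    then have x: "x \<in> X" by (simp add: space_nu)
    interpret P: prob_space "\<pi> x" by (rule policy_sets(3)[OF x])
    interpret P0: prob_space "\<pi>0 x" by (rule policy_sets(4)[OF x])
    have "ennreal (weight \<pi> \<pi>0 x a) * h x a * emeasure (\<pi>0 x) {a} = h x a * emeasure (\<pi> x) {a}"
      if "a \<in> {1..K}" for a
    proof -
      \<comment> \<open>If the behavior mass is 0, the quotient is 0 by convention, and coverage
        forces the target mass to be 0 as well.\<close>
      have "weight \<pi> \<pi>0 x a * measure (\<pi>0 x) {a} = measure (\<pi> x) {a}"
        using elim(1) that
        by (cases "measure (\<pi>0 x) {a} = 0") (auto simp: weight_def zero_less_measure_iff)
      then have "ennreal (weight \<pi> \<pi>0 x a) * emeasure (\<pi>0 x) {a} = emeasure (\<pi> x) {a}"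
        by (simp add: P.emeasure_eq_measure P0.emeasure_eq_measure weight_def flip: ennreal_mult)
      then show ?thesis by (simp add: ac_simps)
    qed
    then show ?case
      by (simp add: nn_integral_finite_space[OF _ policy_sets(1)[OF x]]
          nn_integral_finite_space[OF _ policy_sets(2)[OF x]])
  qed
qed

text \<open>Negated costs are nonnegative and bounded, so extended and Bochner integrals agree. This
  links the iterated integrals to the definition of the risk.\<close>

lemma policy_mean_cost:
  assumes x: "x \<in> X"
  shows "(\<integral>a. mean_cost p x a \<partial>\<pi> x) \<in> {-1..0}"
    and "(\<integral>\<^sup>+a. \<integral>\<^sup>+c. ennreal (- c) \<partial>p (x, a) \<partial>\<pi> x) = ennreal (- (\<integral>a. mean_cost p x a \<partial>\<pi> x))"
proof -
  interpret P: prob_space "\<pi> x" by (rule policy_sets(3)[OF x])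
  have sp: "space (\<pi> x) = {1..K}"
    using sets_eq_imp_space_eq[OF policy_sets(1)[OF x]] by simp
  note int = risk_integrable(1)[OF bandit x]
  have b: "AE a in \<pi> x. mean_cost p x a \<in> {-1..0}"
    using mean_cost_bounds(2)[OF bandit x] by (intro AE_I2) (simp add: sp)
  have "-1 \<le> (\<integral>a. mean_cost p x a \<partial>\<pi> x)"
    using b by (intro P.integral_ge_const[OF int]) auto
  moreover have "(\<integral>a. mean_cost p x a \<partial>\<pi> x) \<le> 0"
    using b by (intro P.integral_le_const[OF int]) auto
  ultimately show "(\<integral>a. mean_cost p x a \<partial>\<pi> x) \<in> {-1..0}" by simp
  have "(\<integral>\<^sup>+a. \<integral>\<^sup>+c. ennreal (- c) \<partial>p (x, a) \<partial>\<pi> x) = (\<integral>\<^sup>+a. ennreal (- mean_cost p x a) \<partial>\<pi> x)"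
  proof (rule nn_integral_cong)
    fix a assume "a \<in> space (\<pi> x)"
    then have a: "a \<in> {1..K}" by (simp add: sp)
    have "(\<integral>\<^sup>+c. ennreal (- c) \<partial>p (x, a)) = ennreal (\<integral>c. - c \<partial>p (x, a))"
      using mean_cost_bounds(1)[OF bandit x a]
      by (intro nn_integral_eq_integral AE_I2) (auto simp: cost_sets(3)[OF x a])
    then show "(\<integral>\<^sup>+c. ennreal (- c) \<partial>p (x, a)) = ennreal (- mean_cost p x a)"
      by (simp add: mean_cost_def)
  qed
  also have "\<dots> = ennreal (\<integral>a. - mean_cost p x a \<partial>\<pi> x)"
    using b int by (intro nn_integral_eq_integral) auto
  finally show "(\<integral>\<^sup>+a. \<integral>\<^sup>+c. ennreal (- c) \<partial>p (x, a) \<partial>\<pi> x) = ennreal (- (\<integral>a. mean_cost p x a \<partial>\<pi> x))"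
    by simp
qed

lemma risk_bounds: "risk \<nu> p \<pi> \<in> {-1..0}"
proof -
  interpret N: prob_space \<nu> by (rule prob_space_nu[OF bandit])
  note int = risk_integrable(2)[OF bandit]
  have b: "AE x in \<nu>. (\<integral>a. mean_cost p x a \<partial>\<pi> x) \<in> {-1..0}"
    using policy_mean_cost(1) by (intro AE_I2) (simp add: space_nu)
  have "-1 \<le> risk \<nu> p \<pi>"
    unfolding risk_def using b by (intro N.integral_ge_const[OF int]) auto
  moreover have "risk \<nu> p \<pi> \<le> 0"
    unfolding risk_def using b by (intro N.integral_le_const[OF int]) auto
  ultimately show ?thesis by simp
qed

text \<open>Exactness of importance sampling. The extended form serves both the bias, through
  \<open>expectation_weighted_cost\<close>, and the finiteness bound \<open>ls_S_le\<close>.\<close>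

lemma nn_integral_neg_weighted_cost:
  assumes cov: "coverage \<nu> K \<pi> \<pi>0"
  shows "(\<integral>\<^sup>+(x, a, c). ennreal (- (weight \<pi> \<pi>0 x a * c)) \<partial>L) = ennreal (- risk \<nu> p \<pi>)"
proof -
  have "(\<lambda>z. ennreal (- (\<lambda>(x, a, c). weight \<pi> \<pi>0 x a * c) z)) \<in> borel_measurable (sample_space X K)"
    using weighted_cost_measurable[OF bandit] by measurable
  then have m: "(\<lambda>(x, a, c). ennreal (- (weight \<pi> \<pi>0 x a * c))) \<in> borel_measurable (sample_space X K)"
    by (simp only: case_prod_beta')
  have "(\<integral>\<^sup>+(x, a, c). ennreal (- (weight \<pi> \<pi>0 x a * c)) \<partial>L)
      = (\<integral>\<^sup>+x. \<integral>\<^sup>+a. \<integral>\<^sup>+c. ennreal (- (weight \<pi> \<pi>0 x a * c)) \<partial>p (x, a) \<partial>\<pi>0 x \<partial>\<nu>)"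
    unfolding nn_integral_logging[OF m] by simp
  \<comment> \<open>The weight does not depend on the cost and leaves the innermost integral, which
    gives the form required by \<open>nn_integral_weighted\<close>.\<close>
  also have "\<dots> = (\<integral>\<^sup>+x. \<integral>\<^sup>+a. ennreal (weight \<pi> \<pi>0 x a) * (\<integral>\<^sup>+c. ennreal (- c) \<partial>p (x, a)) \<partial>\<pi>0 x \<partial>\<nu>)"
  proof (intro nn_integral_cong)
    fix x a
    assume "x \<in> space \<nu>" and a: "a \<in> space (\<pi>0 x)"
    then have x: "x \<in> X" by (simp add: space_nu)
    with a have a: "a \<in> {1..K}"
      using sets_eq_imp_space_eq[OF policy_sets(2)[OF x]] by simp
    have "(\<lambda>c. c) \<in> borel_measurable (p (x, a))"
      using mean_cost_bounds(1)[OF bandit x a] by auto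
    then have "(\<integral>\<^sup>+c. ennreal (weight \<pi> \<pi>0 x a) * ennreal (- c) \<partial>p (x, a))
        = ennreal (weight \<pi> \<pi>0 x a) * (\<integral>\<^sup>+c. ennreal (- c) \<partial>p (x, a))"
      by (intro nn_integral_cmult measurable_compose[OF _ measurable_ennreal] borel_measurable_uminus)
    \<comment> \<open>Costs in the support space are nonpositive, so both factors are nonnegative
      and \<open>ennreal\<close> is multiplicative.\<close>
    moreover have "(\<integral>\<^sup>+c. ennreal (- (weight \<pi> \<pi>0 x a * c)) \<partial>p (x, a))
        = (\<integral>\<^sup>+c. ennreal (weight \<pi> \<pi>0 x a) * ennreal (- c) \<partial>p (x, a))"
      by (intro nn_integral_cong) (simp add: weight_def cost_sets(3)[OF x a] flip: ennreal_mult)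
    ultimately show "(\<integral>\<^sup>+c. ennreal (- (weight \<pi> \<pi>0 x a * c)) \<partial>p (x, a))
        = ennreal (weight \<pi> \<pi>0 x a) * (\<integral>\<^sup>+c. ennreal (- c) \<partial>p (x, a))" by simp
  qed
  also have "\<dots> = (\<integral>\<^sup>+x. \<integral>\<^sup>+a. \<integral>\<^sup>+c. ennreal (- c) \<partial>p (x, a) \<partial>\<pi> x \<partial>\<nu>)"
    by (rule nn_integral_weighted[OF cov])
  also have "\<dots> = (\<integral>\<^sup>+x. ennreal (- (\<integral>a. mean_cost p x a \<partial>\<pi> x)) \<partial>\<nu>)"
    by (intro nn_integral_cong policy_mean_cost(2)) (simp add: space_nu)
  also have "\<dots> = ennreal (\<integral>x. - (\<integral>a. mean_cost p x a \<partial>\<pi> x) \<partial>\<nu>)"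
    using policy_mean_cost(1) risk_integrable(2)[OF bandit]
    by (intro nn_integral_eq_integral AE_I2) (auto simp: space_nu)
  finally show ?thesis by (simp add: risk_def)
qed

lemma expectation_weighted_cost:
  assumes cov: "coverage \<nu> K \<pi> \<pi>0"
  shows "L.expectation (\<lambda>(x, a, c). weight \<pi> \<pi>0 x a * c) = risk \<nu> p \<pi>"
proof -
  let ?g = "\<lambda>(x, a, c). weight \<pi> \<pi>0 x a * c"
  have int: "integrable L (\<lambda>z. - ?g z)"
    using weighted_cost_integrable[OF bandit] by simp
  have "AE z in L. 0 \<le> - ?g z"
    using logging_cost_nonpos[OF bandit]
    by eventually_elim (auto simp: weight_def mult_nonneg_nonpos divide_nonpos_nonneg)
  then have "L.expectation (\<lambda>z. - ?g z) = enn2real (\<integral>\<^sup>+z. ennreal (- ?g z) \<partial>L)"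
    using int by (intro integral_eq_nn_integral) auto
  also have "(\<integral>\<^sup>+z. ennreal (- ?g z) \<partial>L) = ennreal (- risk \<nu> p \<pi>)"
    using nn_integral_neg_weighted_cost[OF cov] by (simp add: case_prod_beta')
  \<comment> \<open>The risk is nonpositive, so \<open>enn2real\<close> recovers its negation
    exactly.\<close>
  finally show ?thesis using risk_bounds by simp
qed

section \<open>Bias and variance of the estimator\<close>

lemma ls_term_integrable:
  assumes "l \<ge> 0"
  shows "integrable L (ls_term \<pi> \<pi>0 l)"
proof (cases "l = 0")
  case True
  then show ?thesis
    using weighted_cost_integrable[OF bandit] by (simp add: ls_term_def)
next
  case False
  then have "integrable L (\<lambda>z. - (\<lambda>(x, a, c). (1 / l) * ln (1 - l * weight \<pi> \<pi>0 x a * c)) z)"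
    using log_weighted_cost_integrable[OF bandit, of l] assms by (intro integrable_minus) simp
  then show ?thesis
    using False by (simp add: ls_term_def case_prod_beta')
qed

text \<open>By linearity and equal marginals, the \<open>n\<close> summands contribute the same
  expectation; \<open>n >= 1\<close> allows the factor \<open>n\<close> to cancel.\<close>

lemma ls_mean_eq:
  assumes "l \<ge> 0" "n \<ge> 1"
  shows "ls_mean X K \<nu> p \<pi> \<pi>0 l n = L.expectation (ls_term \<pi> \<pi>0 l)"
  using assms L.PiM_component_integral[OF _ ls_term_integrable[OF assms(1)], of _ "{1..n}"]
  by (simp add: ls_mean_def data_dist_def ls_estimator_eq_mean)

text \<open>The risk is itself an expectation under the logging distribution, so the bias is the
  integral of a pointwise gap.\<close>

lemma ls_bias_eq:
  assumes "coverage \<nu> K \<pi> \<pi>0" "l \<ge> 0" "n \<ge> 1"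
  shows "ls_bias X K \<nu> p \<pi> \<pi>0 l n
    = L.expectation (\<lambda>z. ls_term \<pi> \<pi>0 l z - (\<lambda>(x, a, c). weight \<pi> \<pi>0 x a * c) z)"
  unfolding ls_bias_def ls_mean_eq[OF assms(2,3)] expectation_weighted_cost[OF assms(1), symmetric]
  by (rule Bochner_Integration.integral_diff[OF ls_term_integrable[OF assms(2)]
        weighted_cost_integrable[OF bandit], symmetric])

lemma ls_bias_nonneg:
  assumes "coverage \<nu> K \<pi> \<pi>0" "l \<ge> 0" "n \<ge> 1"
  shows "0 \<le> ls_bias X K \<nu> p \<pi> \<pi>0 l n"
  unfolding ls_bias_eq[OF assms]
proof (rule integral_nonneg_AE)
  show "AE z in L. 0 \<le> ls_term \<pi> \<pi>0 l z - (\<lambda>(x, a, c). weight \<pi> \<pi>0 x a * c) z"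
    using logging_cost_nonpos[OF bandit] by eventually_elim (auto intro: ls_term_ge[OF assms(2)])
qed

lemma ls_S_integrand_measurable:
  "(\<lambda>(x, a, c). ennreal ((weight \<pi> \<pi>0 x a * c)\<^sup>2 / (1 - l * weight \<pi> \<pi>0 x a * c))) \<in> borel_measurable L"
proof -
  have [measurable]: "(\<lambda>(x, a, c). weight \<pi> \<pi>0 x a * c) \<in> borel_measurable L"
    using weighted_cost_integrable[OF bandit] by (rule borel_measurable_integrable)
  have "(\<lambda>z. ennreal (((\<lambda>(x, a, c). weight \<pi> \<pi>0 x a * c) z)\<^sup>2
      / (1 - l * (\<lambda>(x, a, c). weight \<pi> \<pi>0 x a * c) z))) \<in> borel_measurable L"
    by measurable
  then show ?thesis by (simp add: case_prod_beta' mult.assoc)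
qed

text \<open>The gap is nonnegative, so its integral can be taken in \<open>ennreal\<close>, where
  \<open>ls_term_le\<close> is integrated. At \<open>l = 0\<close> the right-hand side is 0 even if
  the second factor is infinite.\<close>

lemma ls_bias_le:
  assumes "coverage \<nu> K \<pi> \<pi>0" "l \<ge> 0" "n \<ge> 1"
  shows "ennreal (ls_bias X K \<nu> p \<pi> \<pi>0 l n) \<le> ennreal l * ls_S X K \<nu> p \<pi> \<pi>0 l"
proof -
  let ?g = "\<lambda>(x, a, c). weight \<pi> \<pi>0 x a * c"
  let ?s = "\<lambda>(x, a, c). (weight \<pi> \<pi>0 x a * c)\<^sup>2 / (1 - l * weight \<pi> \<pi>0 x a * c)"
  have "ennreal (ls_bias X K \<nu> p \<pi> \<pi>0 l n) = (\<integral>\<^sup>+z. ennreal (ls_term \<pi> \<pi>0 l z - ?g z) \<partial>L)"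
    unfolding ls_bias_eq[OF assms]
  proof (rule nn_integral_eq_integral[symmetric])
    show "integrable L (\<lambda>z. ls_term \<pi> \<pi>0 l z - ?g z)"
      by (intro Bochner_Integration.integrable_diff ls_term_integrable assms weighted_cost_integrable[OF bandit])
    show "AE z in L. 0 \<le> ls_term \<pi> \<pi>0 l z - ?g z"
      using logging_cost_nonpos[OF bandit] by eventually_elim (auto intro: ls_term_ge[OF assms(2)])
  qed
  also have "\<dots> \<le> (\<integral>\<^sup>+z. ennreal l * ennreal (?s z) \<partial>L)"
  proof (rule nn_integral_mono_AE)
    show "AE z in L. ennreal (ls_term \<pi> \<pi>0 l z - ?g z) \<le> ennreal l * ennreal (?s z)"
      using logging_cost_nonpos[OF bandit]
    proof eventually_elim
      case (elim z)
      obtain x a c where z: "z = (x, a, c)" by (cases z)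
      show ?case
        using ls_term_le[OF assms(2), of c \<pi> \<pi>0 x a] elim
        by (simp add: z ennreal_leI flip: ennreal_mult'[OF assms(2)])
    qed
  qed
  also have "\<dots> = ennreal l * (\<integral>\<^sup>+z. ennreal (?s z) \<partial>L)"
    using ls_S_integrand_measurable[of l] by (intro nn_integral_cmult) (simp add: case_prod_beta')
  also have "(\<integral>\<^sup>+z. ennreal (?s z) \<partial>L) = ls_S X K \<nu> p \<pi> \<pi>0 l"
    by (simp add: ls_S_def case_prod_beta')
  finally show ?thesis .
qed

text \<open>The variance of the mean is at most the second moment of one summand over
  \<open>n\<close>, and \<open>ls_term_squared_le\<close> bounds that moment.\<close>

lemma ls_variance_le:
  assumes "l \<ge> 0" "n \<ge> 1"
  shows "ls_variance X K \<nu> p \<pi> \<pi>0 l n \<le> ls_S X K \<nu> p \<pi> \<pi>0 l / of_nat n"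
proof -
  have "ls_variance X K \<nu> p \<pi> \<pi>0 l n \<le> (\<integral>\<^sup>+z. ennreal ((ls_term \<pi> \<pi>0 l z)\<^sup>2) \<partial>L) / of_nat n"
    using L.variance_mean_PiM_le[OF _ _ ls_term_integrable[OF assms(1)], of "{1..n}"] assms
    by (simp add: ls_variance_def data_dist_def ls_estimator_eq_mean ls_mean_eq)
  also have "(\<integral>\<^sup>+z. ennreal ((ls_term \<pi> \<pi>0 l z)\<^sup>2) \<partial>L) \<le> ls_S X K \<nu> p \<pi> \<pi>0 l"
    unfolding ls_S_def
  proof (rule nn_integral_mono_AE)
    show "AE z in L. ennreal ((ls_term \<pi> \<pi>0 l z)\<^sup>2)
        \<le> (\<lambda>(x, a, c). ennreal ((weight \<pi> \<pi>0 x a * c)\<^sup>2 / (1 - l * weight \<pi> \<pi>0 x a * c))) z"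
      using logging_cost_nonpos[OF bandit]
      by eventually_elim (clarsimp intro!: ennreal_leI ls_term_squared_le[OF assms(1)])
  qed
  finally show ?thesis
    by (simp add: divide_right_mono_ennreal)
qed

text \<open>Integrating \<open>ls_S_integrand_le\<close> leaves the mean of the negated weighted
  cost over \<open>l\<close>, and exact importance sampling turns this mean into the absolute
  risk.\<close>

lemma ls_S_le:
  assumes cov: "coverage \<nu> K \<pi> \<pi>0" and l: "l > 0"
  shows "ls_S X K \<nu> p \<pi> \<pi>0 l \<le> ennreal (\<bar>risk \<nu> p \<pi>\<bar> / l)"
proof -
  have "ls_S X K \<nu> p \<pi> \<pi>0 l
      \<le> (\<integral>\<^sup>+z. (\<lambda>(x, a, c). ennreal (- (weight \<pi> \<pi>0 x a * c))) z / ennreal l \<partial>L)"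
    unfolding ls_S_def
  proof (rule nn_integral_mono_AE)
    show "AE z in L. (\<lambda>(x, a, c). ennreal ((weight \<pi> \<pi>0 x a * c)\<^sup>2 / (1 - l * weight \<pi> \<pi>0 x a * c))) z
        \<le> (\<lambda>(x, a, c). ennreal (- (weight \<pi> \<pi>0 x a * c))) z / ennreal l"
      using logging_cost_nonpos[OF bandit]
    proof eventually_elim
      case (elim z)
      obtain x a c where z: "z = (x, a, c)" by (cases z)
      \<comment> \<open>Nonnegativity of the numerator and positivity of \<open>l\<close> identify
        division in \<open>ennreal\<close> with real division.\<close>
      show ?case
        using ls_S_integrand_le[of l c \<pi> \<pi>0 x a] neg_weighted_cost_nonneg[of l c \<pi> \<pi>0 x a] elim l
        by (simp add: z ennreal_leI divide_ennreal)
    qed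
  qed
  also have "\<dots> = (\<integral>\<^sup>+(x, a, c). ennreal (- (weight \<pi> \<pi>0 x a * c)) \<partial>L) / ennreal l"
  proof (rule nn_integral_divide)
    have "(\<lambda>z. ennreal (- (\<lambda>(x, a, c). weight \<pi> \<pi>0 x a * c) z)) \<in> borel_measurable L"
      using weighted_cost_integrable[OF bandit] by measurable
    then show "(\<lambda>(x, a, c). ennreal (- (weight \<pi> \<pi>0 x a * c))) \<in> borel_measurable L"
      by (simp only: case_prod_beta')
  qed
  also have "\<dots> = ennreal (\<bar>risk \<nu> p \<pi>\<bar> / l)"
    unfolding nn_integral_neg_weighted_cost[OF cov] using risk_bounds l by (simp add: divide_ennreal)
  finally show ?thesis .
qed

lemma ls_variance_le_risk:
  assumes "coverage \<nu> K \<pi> \<pi>0" "l > 0" "n \<ge> 1"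
  shows "ls_variance X K \<nu> p \<pi> \<pi>0 l n \<le> ennreal (\<bar>risk \<nu> p \<pi>\<bar> / (l * real n))"
proof -
  have "ls_variance X K \<nu> p \<pi> \<pi>0 l n \<le> ls_S X K \<nu> p \<pi> \<pi>0 l / of_nat n"
    using assms by (intro ls_variance_le) auto
  also have "\<dots> \<le> ennreal (\<bar>risk \<nu> p \<pi>\<bar> / l) / of_nat n"
    by (intro divide_right_mono_ennreal ls_S_le assms)
  also have "\<dots> = ennreal (\<bar>risk \<nu> p \<pi>\<bar> / (l * real n))"
    using assms by (simp add: divide_ennreal ennreal_of_nat_eq_real_of_nat)
  finally show ?thesis .
qed

end

theorem proposition6:
  fixes X :: "(real ^ 'd) set" and K n :: nat and \<nu> :: "(real ^ 'd) measure"
    and p :: "(real ^ 'd) \<times> nat \<Rightarrow> real measure"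
    and \<pi> \<pi>0 :: "real ^ 'd \<Rightarrow> nat measure" and l :: real
  assumes "compact X"
    and "\<nu> \<in> space (prob_algebra (context_space X))"
    and "p \<in> cost_kernels X K"
    and "\<pi>0 \<in> policies X K"
    and "\<pi> \<in> policies X K"
    and "coverage \<nu> K \<pi> \<pi>0"
    and "n \<ge> 1"
    and "l \<ge> 0"
  shows "0 \<le> ls_bias X K \<nu> p \<pi> \<pi>0 l n
    \<and> ennreal (ls_bias X K \<nu> p \<pi> \<pi>0 l n) \<le> ennreal l * ls_S X K \<nu> p \<pi> \<pi>0 l
    \<and> ls_variance X K \<nu> p \<pi> \<pi>0 l n \<le> ls_S X K \<nu> p \<pi> \<pi>0 l / of_nat n
    \<and> (l > 0 \<longrightarrow>
         ls_variance X K \<nu> p \<pi> \<pi>0 l n < \<infinity>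
         \<and> ls_variance X K \<nu> p \<pi> \<pi>0 l n \<le> ennreal (\<bar>risk \<nu> p \<pi>\<bar> / (l * real n))
         \<and> \<bar>risk \<nu> p \<pi>\<bar> / (l * real n) \<le> 1 / (l * real n))"
proof -
  interpret logged_bandit X K \<nu> p \<pi> \<pi>0
    using assms by unfold_locales
  \<comment> \<open>This is also valid at \<open>l = 0\<close>, where both quotients are 0 by
    convention.\<close>
  have "\<bar>risk \<nu> p \<pi>\<bar> / (l * real n) \<le> 1 / (l * real n)"
    using risk_bounds assms by (intro divide_right_mono) auto
  \<comment> \<open>Finiteness is reduced to the risk bound, whose right-hand side is the embedding
    of a real number.\<close>
  moreover have "ls_variance X K \<nu> p \<pi> \<pi>0 l n < \<infinity>"
    if "ls_variance X K \<nu> p \<pi> \<pi>0 l n \<le> ennreal (\<bar>risk \<nu> p \<pi>\<bar> / (l * real n))"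
    using that by (rule order.strict_trans1) simp
  ultimately show ?thesis
    using assms(6-8) ls_bias_nonneg ls_bias_le ls_variance_le ls_variance_le_risk by blast
qed

end
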